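(* Let $M,N\ge1$, $0<p<1$, $q=1-p$. Let $W=(w(i,j))$ be an $M\times N$ matrix whose entries are independent Bernoulli random variables with $P[w(i,j)=1]=p$, $P[w(i,j)=0]=q$, and let $$L(W)=\max\Bigl\{\sum_{(i,j)\in\pi}w(i,j):\ \pi\in\Pi_{M,N}\Bigr\}.$$ Then for every integer $n\ge0$, $$P[L(W)\le n]=\mathbb P_{\mathrm{Kr},N,N+M-1,p}\Bigl[\max_{1\le j\le N}h_j\le n+N-1\Bigr],$$ where $\mathbb P_{\mathrm{Kr},N,K,p}$ is the Krawtchouk ensemble.
   Context: $\Pi_{M,N}$ is the set of all sequences $\pi=\{(k,j_k)\}_{k=1}^M$ with $1\le j_1\le j_2\le\dots\le j_M\le N$ (paths containing exactly one entry in each row of the matrix, with weakly increasing column indices). Krawtchouk ensemble: the probability measure on $\{0,\dots,K\}^N$ given by $$\mathbb P_{\mathrm{Kr},N,K,p}[h]=\frac1{Z_{N,K,p}}\Delta_N(h)^2\prod_{j=1}^N\binom{K}{h_j}p^{h_j}q^{K-h_j},\qquad \Delta_N(h)=\prod_{1\le i<j\le N}(h_j-h_i),$$ $$Z_{N,K,p}=N!\Bigl(\prod_{j=0}^{N-1}\frac{j!}{(K-j)!}\Bigr)(K!)^N(pq)^{N(N-1)/2}.$$ *)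

theory Defs
  imports "HOL-Probability.Probability"
begin

text \<open>A path is represented by its set of entries; this loses nothing, since the rows
  of the entries are pairwise distinct and ordered.\<close>

definition row_paths :: "nat \<Rightarrow> nat \<Rightarrow> (nat \<times> nat) set set" where
  "row_paths M N =
     {(\<lambda>k. (k, j k)) ` {1..M} | j. j ` {1..M} \<subseteq> {1..N} \<and> mono_on {1..M} j}"

definition last_passage :: "nat \<Rightarrow> nat \<Rightarrow> (nat \<times> nat \<Rightarrow> real) \<Rightarrow> real" where
  "last_passage M N w = Max ((\<lambda>\<pi>. \<Sum>e\<in>\<pi>. w e) ` row_paths M N)"

definition vandermonde :: "nat \<Rightarrow> (nat \<Rightarrow> nat) \<Rightarrow> real" where
  "vandermonde N h = (\<Prod>(i, j)\<in>{(i, j). 1 \<le> i \<and> i < j \<and> j \<le> N}. real (h j) - real (h i))"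

text \<open>The subtraction \<open>K - j\<close> on natural numbers below is the true one exactly when
  \<open>N \<le> K + 1\<close>, the only case in which \<open>N\<close> distinct points fit into \<open>{0..K}\<close>.\<close>

definition krawtchouk_Z :: "nat \<Rightarrow> nat \<Rightarrow> real \<Rightarrow> real" where
  "krawtchouk_Z N K p =
     fact N * (\<Prod>j<N. fact j / fact (K - j)) * fact K ^ N * (p * (1 - p)) ^ (N * (N - 1) div 2)"

definition krawtchouk_density :: "nat \<Rightarrow> nat \<Rightarrow> real \<Rightarrow> (nat \<Rightarrow> nat) \<Rightarrow> real" where
  "krawtchouk_density N K p h =
     1 / krawtchouk_Z N K p * (vandermonde N h)\<^sup>2 *
     (\<Prod>j = 1..N. real (K choose h j) * p ^ h j * (1 - p) ^ (K - h j))"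

definition krawtchouk_ensemble :: "nat \<Rightarrow> nat \<Rightarrow> real \<Rightarrow> (nat \<Rightarrow> nat) measure" where
  "krawtchouk_ensemble N K p =
     point_measure ({1..N} \<rightarrow>\<^sub>E {0..K}) (\<lambda>h. ennreal (krawtchouk_density N K p h))"

end

theory Submission
  imports Defs "Jordan_Normal_Form.Determinant"
begin

text \<open>
  The running maxima x(j) over paths ending in column at most j form a Bernoulli jump process with
  pushing. The determinant with rows indexed by particles and entries
  [z^(n + r - x(N - r))] (1 - z)^(r - k - 1) (1 - p + p z)^m is multilinear in the particles, solves
  the free evolution equation, and is unchanged when one particle pushes the next; for m = 0 it is
  the indicator of x(N) \<le> n. Hence it gives the distribution of the last-passage time. Started
  from x = 0 and after a unitriangular row transformation, it becomes the Gram determinant of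
  polynomials for the Krawtchouk weight restricted to {0..n + N - 1}, because
  (1 - z)^r (1 - p + p z)^(K - r) generates the weight times a polynomial of degree r, and
  multiplication by (1 - z)^(-k - 1) sums against a polynomial of degree k.
\<close>

section \<open>Determinants\<close>

text \<open>Entries come from a function on indices, so that determinants are rewritten entrywise
  with no carrier conditions to track.\<close>

definition fdet :: "nat \<Rightarrow> (nat \<Rightarrow> nat \<Rightarrow> 'a) \<Rightarrow> 'a::comm_ring_1" where
  "fdet n f = Determinant.det (Matrix.mat n n (\<lambda>(i, j). f i j))"

lemma fdet_cong: "(\<And>i j. i < n \<Longrightarrow> j < n \<Longrightarrow> f i j = g i j) \<Longrightarrow> fdet n f = fdet n g"
  unfolding fdet_def by (rule arg_cong[of _ _ Determinant.det]) (auto intro!: eq_matI)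

lemma fdet_rows: "fdet n f = (\<Sum>p | p permutes {..<n}. signof p * (\<Prod>i<n. f i (p i)))"
proof -
  have "(\<Prod>i = 0..<n. Matrix.mat n n (\<lambda>(i, j). f i j) $$ (i, p i)) = (\<Prod>i<n. f i (p i))"
    if "p permutes {0..<n}" for p
    unfolding atLeast0LessThan
    by (rule prod.cong) (use that permutes_in_image[OF that] in auto)
  then show ?thesis
    unfolding fdet_def by (subst det_def'[where n = n]) (auto simp: atLeast0LessThan)
qed

lemma fdet_transpose: "fdet n (\<lambda>i j. f j i) = fdet n f"
proof -
  have "Matrix.mat n n (\<lambda>(i, j). f j i) = transpose_mat (Matrix.mat n n (\<lambda>(i, j). f i j))"
    by (rule eq_matI) auto
  then show ?thesis
    unfolding fdet_def by (simp add: det_transpose[where n = n])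
qed

lemma fdet_cols: "fdet n f = (\<Sum>p | p permutes {..<n}. signof p * (\<Prod>j<n. f (p j) j))"
  using fdet_rows[of n "\<lambda>i j. f j i"] by (simp only: fdet_transpose[of n f])

lemma fdet_permute_cols:
  assumes "p permutes {..<n}"
  shows "fdet n (\<lambda>i j. f i (p j)) = signof p * fdet n f"
proof -
  let ?A = "Matrix.mat n n (\<lambda>(i, j). f j i)"
  have "Matrix.mat n n (\<lambda>(i, j). f j (p i)) = Matrix.mat n n (\<lambda>(i, j). ?A $$ (p i, j))"
    using permutes_in_image[OF assms] by (intro eq_matI) auto
  then have "fdet n (\<lambda>i j. f j (p i)) = signof p * fdet n (\<lambda>i j. f j i)"
    unfolding fdet_def using assms
    by (simp add: det_permute_rows[where n = n] atLeast0LessThan)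
  then show ?thesis
    by (simp add: fdet_transpose[of n f] fdet_transpose[of n "\<lambda>i j. f i (p j)"])
qed

lemma fdet_upper_triangular:
  assumes "\<And>i j. j < i \<Longrightarrow> i < n \<Longrightarrow> f i j = 0"
  shows "fdet n f = (\<Prod>i<n. f i i)"
  unfolding fdet_def
  by (subst det_upper_triangular[where n = n])
     (use assms in \<open>auto simp: prod_list_diag_prod atLeast0LessThan intro!: prod.cong\<close>)

lemma fdet_lower_triangular:
  assumes "\<And>i j. i < j \<Longrightarrow> j < n \<Longrightarrow> f i j = 0"
  shows "fdet n f = (\<Prod>i<n. f i i)"
  using fdet_upper_triangular[of n "\<lambda>i j. f j i"] assms by (simp add: fdet_transpose[of n f])

lemma fdet_mult: "fdet n (\<lambda>i j. \<Sum>k<n. f i k * g k j) = fdet n f * fdet n g"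
proof -
  have "Matrix.mat n n (\<lambda>(i, j). \<Sum>k<n. f i k * g k j) =
      Matrix.mat n n (\<lambda>(i, j). f i j) * Matrix.mat n n (\<lambda>(i, j). g i j)"
    by (intro eq_matI) (auto simp: scalar_prod_def atLeast0LessThan)
  then show ?thesis
    unfolding fdet_def by (simp add: det_mult[where n = n])
qed

lemma fdet_zero_row:
  assumes "r < n" "\<And>j. j < n \<Longrightarrow> f r j = 0"
  shows "fdet n f = 0"
  unfolding fdet_rows
proof (intro sum.neutral ballI)
  fix p assume "p \<in> {p. p permutes {..<n}}"
  then have "(\<Prod>i<n. f i (p i)) = 0"
    using assms permutes_in_image[of p "{..<n}" r] by (intro prod_zero bexI[of _ r]) auto
  then show "signof p * (\<Prod>i<n. f i (p i)) = 0" by simp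
qed

lemma fdet_sub_row:
  assumes "r < n" "s < n" "r \<noteq> s"
    and "\<And>j. j < n \<Longrightarrow> g r j = f r j - f s j"
    and "\<And>i j. i < n \<Longrightarrow> j < n \<Longrightarrow> i \<noteq> r \<Longrightarrow> g i j = f i j"
  shows "fdet n g = fdet n f"
proof -
  have "Matrix.mat n n (\<lambda>(i, j). g i j) = addrow (-1) r s (Matrix.mat n n (\<lambda>(i, j). f i j))"
    using assms by (intro eq_matI) (auto simp: mat_addrow_def)
  then show ?thesis
    unfolding fdet_def using assms by (simp add: det_addrow[where n = n])
qed

lemma fdet_last_row:
  assumes "\<And>j. j < n \<Longrightarrow> f n j = 0"
  shows "fdet (Suc n) f = f n n * fdet n f"
proof -
  let ?A = "Matrix.mat (Suc n) (Suc n) (\<lambda>(i, j). f i j)"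
  have "Determinant.det ?A = (\<Sum>j<Suc n. ?A $$ (n, j) * cofactor ?A n j)"
    by (rule laplace_expansion_row) auto
  also have "\<dots> = f n n * cofactor ?A n n"
    using assms by simp
  also have "cofactor ?A n n = Determinant.det (mat_delete ?A n n)"
    by (simp add: cofactor_def flip: power_mult_distrib)
  also have "mat_delete ?A n n = Matrix.mat n n (\<lambda>(i, j). f i j)"
    unfolding mat_delete_def by (intro eq_matI) auto
  finally show ?thesis unfolding fdet_def .
qed

section \<open>Summation over configurations and the Andreief identity\<close>

lemma prod_Suc_shift: "(\<Prod>j<n. f (Suc j)) = (\<Prod>j = 1..n. f j)"
  by (simp add: prod.atLeast1_atMost_eq)

lemma sum_prod_PiE:
  fixes f :: "nat \<Rightarrow> 'b \<Rightarrow> 'a::comm_ring_1"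
  assumes "finite S"
  shows "(\<Sum>h\<in>{1..n} \<rightarrow>\<^sub>E S. \<Prod>j<n. f j (h (Suc j))) = (\<Prod>j<n. \<Sum>x\<in>S. f j x)"
proof -
  have "(\<Prod>j<n. \<Sum>x\<in>S. f j x) = (\<Prod>j = 1..n. \<Sum>x\<in>S. f (j - 1) x)"
    using prod_Suc_shift[of "\<lambda>j. \<Sum>x\<in>S. f (j - 1) x" n] by simp
  also have "\<dots> = (\<Sum>h\<in>{1..n} \<rightarrow>\<^sub>E S. \<Prod>j = 1..n. f (j - 1) (h j))"
    by (rule prod_sum_PiE) (use assms in auto)
  also have "\<dots> = (\<Sum>h\<in>{1..n} \<rightarrow>\<^sub>E S. \<Prod>j<n. f j (h (Suc j)))"
  proof (rule sum.cong[OF refl])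
    fix h :: "nat \<Rightarrow> 'b"
    show "(\<Prod>j = 1..n. f (j - 1) (h j)) = (\<Prod>j<n. f j (h (Suc j)))"
      using prod_Suc_shift[of "\<lambda>j. f (j - 1) (h j)" n] by simp
  qed
  finally show ?thesis ..
qed

text \<open>Andreief's identity, the summation form of Cauchy-Binet. Both determinants are expanded
  over permutations \<open>t\<close> and \<open>s\<close>; the sum over \<open>h\<close> factors
  over the columns, and the sum over \<open>t\<close> leaves the determinant of \<open>?G\<close>
  with columns permuted by \<open>s\<close>. The two signs of \<open>s\<close> cancel, so all
  \<open>n!\<close> terms are equal.\<close>

lemma sum_fdet_mult_fdet:
  fixes f g :: "nat \<Rightarrow> 'b \<Rightarrow> 'a::{comm_ring_1, ring_char_0}"
  assumes "finite S"
  shows "(\<Sum>h\<in>{1..n} \<rightarrow>\<^sub>E S. fdet n (\<lambda>i j. f i (h (Suc j))) * fdet n (\<lambda>i j. g i (h (Suc j)))) =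
    fact n * fdet n (\<lambda>i j. \<Sum>x\<in>S. f i x * g j x)"
proof -
  let ?P = "{p. p permutes {..<n}}"
  let ?G = "\<lambda>i j. \<Sum>x\<in>S. f i x * g j x"
  have inner: "(\<Sum>h\<in>{1..n} \<rightarrow>\<^sub>E S. fdet n (\<lambda>i j. f i (h (Suc j))) * (\<Prod>j<n. g (s j) (h (Suc j)))) =
      signof s * fdet n ?G" if "s permutes {..<n}" for s
  proof -
    have "(\<Sum>h\<in>{1..n} \<rightarrow>\<^sub>E S. fdet n (\<lambda>i j. f i (h (Suc j))) * (\<Prod>j<n. g (s j) (h (Suc j)))) =
        (\<Sum>h\<in>{1..n} \<rightarrow>\<^sub>E S. \<Sum>t\<in>?P. signof t * (\<Prod>j<n. f (t j) (h (Suc j)) * g (s j) (h (Suc j))))"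
      by (simp add: fdet_cols sum_distrib_right prod.distrib mult.assoc)
    also have "\<dots> = (\<Sum>t\<in>?P. signof t * (\<Sum>h\<in>{1..n} \<rightarrow>\<^sub>E S. \<Prod>j<n. f (t j) (h (Suc j)) * g (s j) (h (Suc j))))"
      by (subst sum.swap) (simp add: sum_distrib_left)
    also have "\<dots> = fdet n (\<lambda>i j. ?G i (s j))"
      unfolding sum_prod_PiE[OF assms, where n = n and f = "\<lambda>j x. f (t j) x * g (s j) x" for t] fdet_cols ..
    finally show ?thesis by (simp add: fdet_permute_cols[OF that, of ?G])
  qed
  have "(\<Sum>h\<in>{1..n} \<rightarrow>\<^sub>E S. fdet n (\<lambda>i j. f i (h (Suc j))) * fdet n (\<lambda>i j. g i (h (Suc j)))) =
      (\<Sum>s\<in>?P. signof s * (\<Sum>h\<in>{1..n} \<rightarrow>\<^sub>E S.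
         fdet n (\<lambda>i j. f i (h (Suc j))) * (\<Prod>j<n. g (s j) (h (Suc j)))))"
    by (subst fdet_cols[of n "\<lambda>i j. g i (h (Suc j))" for h], subst sum_distrib_left, subst sum.swap)
       (simp add: sum_distrib_left mult_ac)
  also have "\<dots> = (\<Sum>s\<in>?P. fdet n ?G)"
  proof (rule sum.cong[OF refl])
    fix s assume "s \<in> ?P"
    then have "signof s * (\<Sum>h\<in>{1..n} \<rightarrow>\<^sub>E S.
         fdet n (\<lambda>i j. f i (h (Suc j))) * (\<Prod>j<n. g (s j) (h (Suc j)))) =
        of_int (sign s * sign s) * fdet n ?G"
      by (simp only: inner mem_Collect_eq of_int_mult mult.assoc)
    then show "signof s * (\<Sum>h\<in>{1..n} \<rightarrow>\<^sub>E S.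
         fdet n (\<lambda>i j. f i (h (Suc j))) * (\<Prod>j<n. g (s j) (h (Suc j)))) = fdet n ?G"
      by (simp only: sign_idempotent of_int_1 mult_1)
  qed
  also have "\<dots> = fact n * fdet n ?G"
    by (simp add: card_permutations[OF refl])
  finally show ?thesis .
qed

section \<open>Polynomial rows and the Vandermonde determinant\<close>

text \<open>The degree bound \<open>i\<close> in row \<open>i\<close> factors the matrix into a
  lower triangular coefficient matrix and the Vandermonde matrix, so only the diagonal coefficients
  survive.\<close>

lemma fdet_poly_lead:
  fixes y :: "nat \<Rightarrow> 'a::comm_ring_1"
  assumes "\<And>i. i < n \<Longrightarrow> degree (P i) \<le> i"
  shows "fdet n (\<lambda>i j. poly (P i) (y j)) =
    (\<Prod>i<n. coeff (P i) i) * fdet n (\<lambda>i j. y j ^ i)"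
proof -
  have "fdet n (\<lambda>i j. poly (P i) (y j)) = fdet n (\<lambda>i j. \<Sum>k<n. coeff (P i) k * y j ^ k)"
  proof (rule fdet_cong)
    fix i j assume "i < n" "j < n"
    have "poly (P i) (y j) = (\<Sum>k\<le>degree (P i). coeff (P i) k * y j ^ k)"
      by (rule poly_altdef)
    also have "\<dots> = (\<Sum>k<n. coeff (P i) k * y j ^ k)"
      using assms[OF \<open>i < n\<close>] \<open>i < n\<close>
      by (intro sum.mono_neutral_left) (auto simp: coeff_eq_0)
    finally show "poly (P i) (y j) = (\<Sum>k<n. coeff (P i) k * y j ^ k)" .
  qed
  also have "\<dots> = fdet n (\<lambda>i k. coeff (P i) k) * fdet n (\<lambda>k j. y j ^ k)"
    by (rule fdet_mult)
  also have "fdet n (\<lambda>i k. coeff (P i) k) = (\<Prod>i<n. coeff (P i) i)"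
    by (rule fdet_lower_triangular) (meson assms coeff_eq_0 dual_order.strict_trans2 dual_order.strict_trans)
  finally show ?thesis .
qed

lemma fdet_vandermonde:
  fixes y :: "nat \<Rightarrow> 'a::idom"
  shows "fdet n (\<lambda>i j. y j ^ i) = (\<Prod>j<n. \<Prod>i<j. y j - y i)"
proof (induction n)
  case 0
  then show ?case by (simp add: fdet_rows)
next
  case (Suc n)
  \<comment> \<open>Only the last row changes: \<open>P n\<close> is monic with roots
    \<open>y 0, ..., y (n - 1)\<close>, so the determinant stays the same and its last row vanishes
    off the corner.\<close>
  define P where "P i = (if i < n then monom 1 i else \<Prod>k<n. [:- y k, 1:])" for i
  have deg: "degree (P i) \<le> i" if "i < Suc n" for i
    using that by (auto simp: P_def degree_monom_eq degree_linear_power intro: order.trans[OF degree_prod_sum_le])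
  have lead: "coeff (P i) i = 1" if "i < Suc n" for i
  proof (cases "i < n")
    case False
    then have "i = n" using that by simp
    moreover have "degree (\<Prod>k<n. [:- y k, 1:]) = n" by (simp add: degree_prod_eq_sum_degree)
    moreover have "lead_coeff (\<Prod>k<n. [:- y k, 1:]) = 1" by (simp add: lead_coeff_prod)
    ultimately show ?thesis by (simp add: P_def)
  qed (simp add: P_def)
  have "fdet (Suc n) (\<lambda>i j. y j ^ i) = fdet (Suc n) (\<lambda>i j. poly (P i) (y j))"
    using fdet_poly_lead[of "Suc n" P y] deg lead by simp
  also have "\<dots> = poly (P n) (y n) * fdet n (\<lambda>i j. poly (P i) (y j))"
    by (rule fdet_last_row) (auto simp: P_def poly_prod)
  also have "fdet n (\<lambda>i j. poly (P i) (y j)) = fdet n (\<lambda>i j. y j ^ i)"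
    by (rule fdet_cong) (simp add: P_def poly_monom)
  finally show ?case
    using Suc.IH by (simp add: P_def poly_prod mult.commute)
qed

lemma vandermonde_eq_fdet: "vandermonde N h = fdet N (\<lambda>i j. real (h (Suc j)) ^ i)"
proof -
  have "vandermonde N h = (\<Prod>(j, i)\<in>Sigma {..<N} (\<lambda>j. {..<j}). real (h (Suc j)) - real (h (Suc i)))"
    unfolding vandermonde_def
    by (rule prod.reindex_bij_witness[where i = "\<lambda>(j, i). (Suc i, Suc j)" and j = "\<lambda>(i, j). (j - 1, i - 1)"])
       auto
  also have "\<dots> = (\<Prod>j<N. \<Prod>i<j. real (h (Suc j)) - real (h (Suc i)))"
    by (rule prod.Sigma[symmetric]) auto
  finally show ?thesis by (simp add: fdet_vandermonde)
qed

section \<open>The jump process with pushing\<close>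

text \<open>Integer indices with value zero below 0 make multiplication by \<open>fps_X\<close> an
  exact index shift, also at the boundary, where natural subtraction would truncate.\<close>

definition coefz :: "real fps \<Rightarrow> int \<Rightarrow> real" where
  "coefz F t = (if t < 0 then 0 else fps_nth F (nat t))"

definition bernoulli_gf :: "real \<Rightarrow> real fps" where
  "bernoulli_gf p = fps_const (1 - p) + fps_const p * fps_X"

definition geometric_gf :: "real fps" where
  "geometric_gf = inverse (1 - fps_X)"

lemma one_minus_X_mult_geometric_gf: "(1 - fps_X) * geometric_gf = 1"
  unfolding geometric_gf_def by (subst mult.commute) (rule inverse_mult_eq_1, simp)

lemma one_minus_X_mult_nth:
  "fps_nth ((1 - fps_X) * F) t = fps_nth F t - (if t = 0 then 0 else fps_nth F (t - 1))"
  for F :: "real fps"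
  by (simp add: left_diff_distrib)

lemma coefz_one_minus_X_mult: "coefz ((1 - fps_X) * F) t = coefz F t - coefz F (t - 1)"
  by (auto simp: coefz_def one_minus_X_mult_nth nat_diff_distrib nat_eq_iff)

lemma coefz_bernoulli_mult: "coefz (bernoulli_gf p * F) t = (1 - p) * coefz F t + p * coefz F (t - 1)"
  by (auto simp: coefz_def bernoulli_gf_def distrib_right mult.assoc nat_diff_distrib nat_eq_iff)

lemma one_minus_X_power_nth: "d < t \<Longrightarrow> fps_nth ((1 - fps_X) ^ d :: real fps) t = 0"
  by (induction d arbitrary: t) (auto simp: one_minus_X_mult_nth)

text \<open>The factor \<open>(1 - z)^(r - k - 1)\<close> may have a negative exponent and is
  therefore split into two natural powers. Here \<open>r\<close> is the row, \<open>k\<close> the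
  column, \<open>m\<close> the time left and \<open>x\<close> the position of the particle.\<close>

definition kernel_entry :: "real \<Rightarrow> nat \<Rightarrow> nat \<Rightarrow> nat \<Rightarrow> nat \<Rightarrow> nat \<Rightarrow> real" where
  "kernel_entry p n m r k x = coefz ((1 - fps_X) ^ r * geometric_gf ^ Suc k * bernoulli_gf p ^ m) (int n + int r - int x)"

text \<open>Free evolution: lowering the coefficient index by one is the same as raising
  \<open>x\<close> by one, so the extra factor \<open>bernoulli_gf p\<close> averages over one
  Bernoulli jump.\<close>

lemma kernel_entry_Suc_time: "kernel_entry p n (Suc m) r k x = (1 - p) * kernel_entry p n m r k x + p * kernel_entry p n m r k (Suc x)"
proof -
  define F where "F = (1 - fps_X) ^ r * geometric_gf ^ Suc k * bernoulli_gf p ^ m"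
  have "(1 - fps_X) ^ r * geometric_gf ^ Suc k * bernoulli_gf p ^ Suc m = bernoulli_gf p * F"
    by (simp add: F_def mult_ac)
  moreover have "int n + int r - int (Suc x) = int n + int r - int x - 1"
    by simp
  ultimately show ?thesis
    by (simp only: kernel_entry_def F_def[symmetric] coefz_bernoulli_mult)
qed

text \<open>An extra factor \<open>1 - z\<close> is a difference in the coefficient index. The shift
  by \<open>r\<close> in that index aligns row \<open>Suc r\<close> at \<open>Suc x\<close> with row
  \<open>r\<close> at \<open>x\<close>; this is the relation behind pushing.\<close>

lemma kernel_entry_Suc_row: "kernel_entry p n m (Suc r) k (Suc x) = kernel_entry p n m r k x - kernel_entry p n m r k (Suc x)"
proof -
  define F where "F = (1 - fps_X) ^ r * geometric_gf ^ Suc k * bernoulli_gf p ^ m"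
  have "(1 - fps_X) ^ Suc r * geometric_gf ^ Suc k * bernoulli_gf p ^ m = (1 - fps_X) * F"
    by (simp add: F_def mult_ac)
  moreover have "int n + int (Suc r) - int (Suc x) = int n + int r - int x"
    "int n + int r - int (Suc x) = int n + int r - int x - 1"
    by simp_all
  ultimately show ?thesis
    by (simp only: kernel_entry_def F_def[symmetric] coefz_one_minus_X_mult)
qed

lemma one_minus_X_power_mult_geometric_gf_power:
  "(1 - fps_X) ^ (k + d) * geometric_gf ^ k = (1 - fps_X) ^ d"
  by (simp add: power_add mult_ac one_minus_X_mult_geometric_gf flip: power_mult_distrib)
     (simp add: mult.commute[of geometric_gf] one_minus_X_mult_geometric_gf)

text \<open>What remains is the polynomial \<open>(1 - z)^(r - k - 1)\<close>, whose degree is below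
  \<open>r\<close>, while the coefficient index \<open>n + r - x\<close> is at least
  \<open>r\<close>.\<close>

lemma kernel_entry_0_below_diag: "k < r \<Longrightarrow> x \<le> n \<Longrightarrow> kernel_entry p n 0 r k x = 0"
proof -
  assume "k < r" "x \<le> n"
  then obtain d where d: "r = Suc k + d"
    using less_iff_Suc_add by auto
  have "(1 - fps_X) ^ r * geometric_gf ^ Suc k = (1 - fps_X) ^ d"
    unfolding d by (rule one_minus_X_power_mult_geometric_gf_power)
  then show ?thesis
    using \<open>x \<le> n\<close> by (simp add: kernel_entry_def coefz_def d one_minus_X_power_nth del: power_Suc)
qed

lemma geometric_gf_nth: "fps_nth geometric_gf t = 1"
proof (induction t)
  case 0
  then show ?case by (simp add: geometric_gf_def)
next
  case (Suc t)
  then show ?case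
    using one_minus_X_mult_nth[of geometric_gf "Suc t"] by (simp add: one_minus_X_mult_geometric_gf)
qed

lemma kernel_entry_0_diag: "x \<le> n \<Longrightarrow> kernel_entry p n 0 r r x = 1"
proof -
  assume "x \<le> n"
  have "(1 - fps_X) ^ r * geometric_gf ^ Suc r = ((1 - fps_X) ^ (r + 0) * geometric_gf ^ r) * geometric_gf"
    by (simp add: mult_ac)
  also have "\<dots> = geometric_gf"
    by (simp only: one_minus_X_power_mult_geometric_gf_power) simp
  finally show ?thesis
    using \<open>x \<le> n\<close> by (simp add: kernel_entry_def coefz_def geometric_gf_nth del: power_Suc)
qed

lemma kernel_entry_0_beyond: "n < x \<Longrightarrow> kernel_entry p n m 0 k x = 0"
  by (simp add: kernel_entry_def coefz_def)

section \<open>The distribution determinant\<close>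

text \<open>Row \<open>r\<close> belongs to particle \<open>N - r\<close>, so that row 0 is the last
  particle and each row is followed by that of the particle that can push it. From
  \<open>x = 0\<close> the value is the probability that particle \<open>N\<close> is at most at
  \<open>n\<close> after \<open>m\<close> steps.\<close>

definition dist_det :: "real \<Rightarrow> nat \<Rightarrow> nat \<Rightarrow> nat \<Rightarrow> (nat \<Rightarrow> nat) \<Rightarrow> real" where
  "dist_det p n N m x = fdet N (\<lambda>r k. kernel_entry p n m r k (x (N - r)))"

lemma dist_det_cong:
  "(\<And>j. 1 \<le> j \<Longrightarrow> j \<le> N \<Longrightarrow> x j = y j) \<Longrightarrow> dist_det p n N m x = dist_det p n N m y"
  unfolding dist_det_def by (rule fdet_cong) auto

text \<open>With all particles at most at \<open>n\<close>, the matrix at time 0 is upper triangular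
  with unit diagonal. If the last particle is beyond \<open>n\<close>, row 0 consists of
  coefficients with negative index.\<close>

lemma dist_det_0:
  assumes "1 \<le> N" "\<And>j. 1 \<le> j \<Longrightarrow> j \<le> N \<Longrightarrow> x j \<le> x N"
  shows "dist_det p n N 0 x = (if x N \<le> n then 1 else 0)"
proof (cases "x N \<le> n")
  case True
  have le: "x (N - r) \<le> n" if "r < N" for r
    using order.trans[OF assms(2) True, of "N - r"] that by simp
  have "dist_det p n N 0 x = (\<Prod>r<N. kernel_entry p n 0 r r (x (N - r)))"
    unfolding dist_det_def
    by (rule fdet_upper_triangular) (simp add: kernel_entry_0_below_diag le)
  also have "\<dots> = 1"
    by (rule prod.neutral) (simp add: kernel_entry_0_diag le)
  finally show ?thesis using True by simp
next
  case False
  have "dist_det p n N 0 x = 0"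
    unfolding dist_det_def
    by (rule fdet_zero_row[of 0]) (use assms False in \<open>auto simp: kernel_entry_0_beyond\<close>)
  with False show ?thesis by simp
qed

text \<open>By \<open>kernel_entry_Suc_row\<close>, advancing particle \<open>j\<close> from one
  site behind particle \<open>j - 1\<close> subtracts the row of \<open>j - 1\<close> from the row
  of \<open>j\<close>. A configuration with this order violation thus has the same value as the one
  after the push.\<close>

lemma dist_det_push:
  assumes "1 < j" "j \<le> N" "x (j - 1) = Suc (x j)"
  shows "dist_det p n N m (x(j := Suc (x j))) = dist_det p n N m x"
  unfolding dist_det_def
proof (rule fdet_sub_row[of "N - j" _ "Suc (N - j)"])
  show "kernel_entry p n m (N - j) k ((x(j := Suc (x j))) (N - (N - j))) =
      kernel_entry p n m (N - j) k (x (N - (N - j))) -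
      kernel_entry p n m (Suc (N - j)) k (x (N - Suc (N - j)))" for k
    using assms by (simp add: kernel_entry_Suc_row diff_Suc)
  show "kernel_entry p n m i k ((x(j := Suc (x j))) (N - i)) = kernel_entry p n m i k (x (N - i))"
    if "i < N" "k < N" "i \<noteq> N - j" for i k
    using that by auto
qed (use assms in auto)

lemma sum_prod_PiE_rev:
  fixes f :: "nat \<Rightarrow> 'b \<Rightarrow> 'a::comm_ring_1"
  assumes "finite S"
  shows "(\<Sum>w\<in>{1..n} \<rightarrow>\<^sub>E S. \<Prod>r<n. f r (w (n - r))) = (\<Prod>r<n. \<Sum>b\<in>S. f r b)"
proof -
  have "(\<Prod>r<n. f r (w (n - r))) = (\<Prod>j<n. f (n - Suc j) (w (Suc j)))" for w
    by (subst prod.nat_diff_reindex[symmetric]) (auto intro!: prod.cong simp: Suc_diff_Suc)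
  then have "(\<Sum>w\<in>{1..n} \<rightarrow>\<^sub>E S. \<Prod>r<n. f r (w (n - r))) =
      (\<Prod>j<n. \<Sum>b\<in>S. f (n - Suc j) b)"
    by (simp only: sum_prod_PiE[OF assms, where n = n and f = "\<lambda>j. f (n - Suc j)"])
  also have "\<dots> = (\<Prod>r<n. \<Sum>b\<in>S. f r b)"
    by (rule prod.nat_diff_reindex)
  finally show ?thesis .
qed

definition bernoulli_weight :: "real \<Rightarrow> nat \<Rightarrow> real" where
  "bernoulli_weight p b = (if b = 1 then p else 1 - p)"

text \<open>Particle \<open>N - r\<close> occurs only in row \<open>r\<close>, so in the Leibniz
  expansion the average over independent jumps acts on each factor separately, by
  \<open>kernel_entry_Suc_time\<close>.\<close>

lemma dist_det_step:
  "(\<Sum>w\<in>{1..N} \<rightarrow>\<^sub>E {0, 1}. (\<Prod>j = 1..N. bernoulli_weight p (w j)) * dist_det p n N m (\<lambda>j. x j + w j)) =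
    dist_det p n N (Suc m) x"
proof -
  let ?P = "{s. s permutes {..<N}}"
  have rev: "(\<Prod>j = 1..N. bernoulli_weight p (w j)) = (\<Prod>r<N. bernoulli_weight p (w (N - r)))" for w
    by (rule prod.reindex_bij_witness[where i = "\<lambda>r. N - r" and j = "\<lambda>j. N - j"]) auto
  have "(\<Sum>w\<in>{1..N} \<rightarrow>\<^sub>E {0, 1}. (\<Prod>j = 1..N. bernoulli_weight p (w j)) * dist_det p n N m (\<lambda>j. x j + w j)) =
      (\<Sum>w\<in>{1..N} \<rightarrow>\<^sub>E {0, 1}. \<Sum>s\<in>?P. signof s *
        (\<Prod>r<N. bernoulli_weight p (w (N - r)) * kernel_entry p n m r (s r) (x (N - r) + w (N - r))))"
    by (simp only: dist_det_def fdet_rows rev sum_distrib_left prod.distrib mult_ac)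
  also have "\<dots> = (\<Sum>s\<in>?P. signof s * (\<Sum>w\<in>{1..N} \<rightarrow>\<^sub>E {0, 1}.
        \<Prod>r<N. bernoulli_weight p (w (N - r)) * kernel_entry p n m r (s r) (x (N - r) + w (N - r))))"
    by (subst sum.swap) (simp only: sum_distrib_left)
  also have "\<dots> = (\<Sum>s\<in>?P. signof s * (\<Prod>r<N. kernel_entry p n (Suc m) r (s r) (x (N - r))))"
  proof (intro sum.cong refl arg_cong2[of _ _ _ _ "(*)"])
    fix s
    show "(\<Sum>w\<in>{1..N} \<rightarrow>\<^sub>E {0, 1}.
        \<Prod>r<N. bernoulli_weight p (w (N - r)) * kernel_entry p n m r (s r) (x (N - r) + w (N - r))) =
        (\<Prod>r<N. kernel_entry p n (Suc m) r (s r) (x (N - r)))"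
      using sum_prod_PiE_rev[where n = N and S = "{0, 1 :: nat}" and
          f = "\<lambda>r b. bernoulli_weight p b * kernel_entry p n m r (s r) (x (N - r) + b)"]
      by (simp add: bernoulli_weight_def kernel_entry_Suc_time)
  qed
  finally show ?thesis by (simp only: dist_det_def fdet_rows)
qed

section \<open>The last-passage recursion and pushing\<close>

text \<open>A best path is split by whether its last entry lies in the last column. The value 0 in
  column 0, where no path through a positive number of rows exists, does no harm in the maximum
  because the weights are natural numbers.\<close>

fun passage :: "(nat \<times> nat \<Rightarrow> nat) \<Rightarrow> nat \<Rightarrow> nat \<Rightarrow> nat" where
  "passage W 0 j = 0"
| "passage W (Suc m) 0 = 0"
| "passage W (Suc m) (Suc j) = max (passage W (Suc m) j) (passage W m (Suc j) + W (Suc m, Suc j))"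

lemma passage_0_right [simp]: "passage W m 0 = 0"
  by (cases m) auto

lemma passage_mono: "i \<le> j \<Longrightarrow> passage W m i \<le> passage W m j"
proof (induction j rule: dec_induct)
  case (step j)
  then show ?case by (cases m) (auto simp: le_max_iff_disj)
qed simp

lemma passage_cong:
  assumes "\<And>i l. i \<in> {1..m} \<Longrightarrow> l \<in> {1..j} \<Longrightarrow> W (i, l) = W' (i, l)"
  shows "passage W m j = passage W' m j"
  using assms by (induction W m j rule: passage.induct) auto

text \<open>Entries at most 1 bound both branches of the maximum, the left one by induction and
  \<open>passage_mono\<close>. This keeps every push to a single site.\<close>

lemma passage_Suc_le:
  assumes "\<And>l. 1 \<le> l \<Longrightarrow> l \<le> j \<Longrightarrow> W (Suc m, l) \<le> 1"
  shows "passage W (Suc m) j \<le> Suc (passage W m j)"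
  using assms
proof (induction j)
  case (Suc j)
  have "passage W (Suc m) j \<le> Suc (passage W m j)"
    using Suc by simp
  also have "\<dots> \<le> Suc (passage W m (Suc j))"
    by (simp add: passage_mono)
  finally show ?case using Suc.prems[of "Suc j"] by simp
qed simp

text \<open>The free positions \<open>z\<close> are turned into the true positions \<open>y\<close>
  one particle at a time from the left; each correction is void or a single push covered by
  \<open>dist_det_push\<close>.\<close>

lemma dist_det_passage_Suc:
  assumes W: "\<And>l. 1 \<le> l \<Longrightarrow> l \<le> N \<Longrightarrow> W (Suc m, l) \<le> 1"
  shows "dist_det p n N k (passage W (Suc m)) =
    dist_det p n N k (\<lambda>j. passage W m j + W (Suc m, j))"
proof -
  define y where "y = passage W (Suc m)"
  define z where "z = (\<lambda>j. passage W m j + W (Suc m, j))"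
  have "dist_det p n N k (\<lambda>j. if j \<le> i then y j else z j) = dist_det p n N k z" if "i \<le> N" for i
    using that
  proof (induction i)
    case 0
    show ?case by (rule dist_det_cong) simp
  next
    case (Suc i)
    let ?x = "\<lambda>j. if j \<le> i then y j else z j"
    have y: "y (Suc i) = max (y i) (z (Suc i))"
      by (simp add: y_def z_def)
    \<comment> \<open>Particle \<open>i\<close> was not ahead of particle \<open>Suc i\<close>
      before the step and gains at most one site, so it overtakes \<open>Suc i\<close> by at most
      one.\<close>
    have "y i \<le> Suc (z (Suc i))"
      using passage_Suc_le[of i W m] W Suc.prems passage_mono[of i "Suc i" W m]
      by (fastforce simp: y_def z_def)
    then consider "y (Suc i) = z (Suc i)" | "y i = Suc (z (Suc i))" "y (Suc i) = Suc (z (Suc i))"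
      using y by linarith
    then have "dist_det p n N k (\<lambda>j. if j \<le> Suc i then y j else z j) = dist_det p n N k ?x"
    proof cases
      case 1
      then show ?thesis by (intro dist_det_cong) (auto simp: le_Suc_eq)
    next
      case 2
      \<comment> \<open>Index 0 is not a particle but holds the value 0, so the first particle is
        never pushed.\<close>
      have "i \<noteq> 0"
      proof
        assume "i = 0"
        then have "y i = 0" by (simp add: y_def)
        with 2 show False by simp
      qed
      have "(\<lambda>j. if j \<le> Suc i then y j else z j) = ?x(Suc i := Suc (?x (Suc i)))"
        using 2 by (auto simp: le_Suc_eq)
      then show ?thesis
        using dist_det_push[of "Suc i" N ?x] 2 \<open>i \<noteq> 0\<close> Suc.prems by simp
    qed
    with Suc show ?case by simp
  qed
  from this[of N] show ?thesis
    unfolding y_def[symmetric] z_def[symmetric]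
    using dist_det_cong[of N y "\<lambda>j. if j \<le> N then y j else z j"] by simp
qed

section \<open>Summation over the grid, row by row\<close>

lemma sum_grid_Suc:
  fixes F :: "(nat \<times> nat \<Rightarrow> 'b) \<Rightarrow> 'a::comm_monoid_add"
  shows "(\<Sum>W\<in>{1..Suc m} \<times> {1..N} \<rightarrow>\<^sub>E S. F W) =
    (\<Sum>W\<in>{1..m} \<times> {1..N} \<rightarrow>\<^sub>E S. \<Sum>w\<in>{1..N} \<rightarrow>\<^sub>E S.
      F (\<lambda>(i, j). if i = Suc m then w j else W (i, j)))"
proof -
  have "(\<Sum>W\<in>{1..Suc m} \<times> {1..N} \<rightarrow>\<^sub>E S. F W) =
      (\<Sum>(W, w)\<in>({1..m} \<times> {1..N} \<rightarrow>\<^sub>E S) \<times> ({1..N} \<rightarrow>\<^sub>E S).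
        F (\<lambda>(i, j). if i = Suc m then w j else W (i, j)))"
  proof (rule sum.reindex_bij_witness[where
        i = "\<lambda>(W, w). \<lambda>(i, j). if i = Suc m then w j else W (i, j)" and
        j = "\<lambda>W. (restrict W ({1..m} \<times> {1..N}), \<lambda>j\<in>{1..N}. W (Suc m, j))"])
    fix W assume W: "W \<in> {1..Suc m} \<times> {1..N} \<rightarrow>\<^sub>E S"
    show eq: "(case (restrict W ({1..m} \<times> {1..N}), \<lambda>j\<in>{1..N}. W (Suc m, j)) of
        (W, w) \<Rightarrow> \<lambda>(i, j). if i = Suc m then w j else W (i, j)) = W"
      using PiE_arb[OF W] by (auto simp: fun_eq_iff restrict_def)
    show "(case (restrict W ({1..m} \<times> {1..N}), \<lambda>j\<in>{1..N}. W (Suc m, j)) of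
        (W, w) \<Rightarrow> F (\<lambda>(i, j). if i = Suc m then w j else W (i, j))) = F W"
      using eq by simp
    show "(restrict W ({1..m} \<times> {1..N}), \<lambda>j\<in>{1..N}. W (Suc m, j)) \<in>
        ({1..m} \<times> {1..N} \<rightarrow>\<^sub>E S) \<times> ({1..N} \<rightarrow>\<^sub>E S)"
      using W by (auto simp: PiE_iff)
  next
    fix Ww assume "Ww \<in> ({1..m} \<times> {1..N} \<rightarrow>\<^sub>E S) \<times> ({1..N} \<rightarrow>\<^sub>E S)"
    then obtain W w where Ww: "Ww = (W, w)" and W: "W \<in> {1..m} \<times> {1..N} \<rightarrow>\<^sub>E S"
      and w: "w \<in> {1..N} \<rightarrow>\<^sub>E S" by auto
    show "(restrict (case Ww of (W, w) \<Rightarrow> \<lambda>(i, j). if i = Suc m then w j else W (i, j)) ({1..m} \<times> {1..N}),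
        \<lambda>j\<in>{1..N}. (case Ww of (W, w) \<Rightarrow> \<lambda>(i, j). if i = Suc m then w j else W (i, j)) (Suc m, j)) = Ww"
      using PiE_arb[OF W] PiE_arb[OF w] by (auto simp: Ww fun_eq_iff restrict_def)
    show "(case Ww of (W, w) \<Rightarrow> \<lambda>(i, j). if i = Suc m then w j else W (i, j)) \<in>
        {1..Suc m} \<times> {1..N} \<rightarrow>\<^sub>E S"
      using W w by (auto simp: Ww PiE_iff extensional_def le_Suc_eq)
  qed
  then show ?thesis by (simp add: sum.cartesian_product)
qed

lemma prod_grid_Suc:
  "(\<Prod>e\<in>{1..Suc m} \<times> {1..N}. f e) = (\<Prod>e\<in>{1..m} \<times> {1..N}. f e) * (\<Prod>j = 1..N. f (Suc m, j))"
  for f :: "nat \<times> nat \<Rightarrow> 'a::comm_monoid_mult"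
proof -
  have "(\<Prod>e\<in>{1..Suc m} \<times> {1..N}. f e) = (\<Prod>i = 1..Suc m. \<Prod>j = 1..N. f (i, j))"
    by (simp add: prod.cartesian_product)
  also have "\<dots> = (\<Prod>i = 1..m. \<Prod>j = 1..N. f (i, j)) * (\<Prod>j = 1..N. f (Suc m, j))"
    by simp
  finally show ?thesis by (simp add: prod.cartesian_product)
qed

text \<open>The last row is summed out first: its jumps may be taken as free by
  \<open>dist_det_passage_Suc\<close>, and \<open>dist_det_step\<close> trades them for one more
  unit of time. Hence the induction over \<open>m\<close> needs \<open>k\<close> arbitrary.\<close>

lemma expectation_dist_det:
  "(\<Sum>W\<in>{1..m} \<times> {1..N} \<rightarrow>\<^sub>E {0, 1}.
      (\<Prod>e\<in>{1..m} \<times> {1..N}. bernoulli_weight p (W e)) * dist_det p n N k (passage W m)) =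
    dist_det p n N (m + k) (\<lambda>_. 0)"
proof (induction m arbitrary: k)
  case 0
  have "passage W 0 = (\<lambda>_. 0)" for W by auto
  then show ?case by simp
next
  case (Suc m)
  let ?grid = "{1..m} \<times> {1..N}"
  let ?E = "\<lambda>W w. \<lambda>(i, j). if i = Suc m then w j else W (i, j)"
  have step: "(\<Prod>e\<in>{1..Suc m} \<times> {1..N}. bernoulli_weight p (?E W w e)) *
        dist_det p n N k (passage (?E W w) (Suc m)) =
      (\<Prod>e\<in>?grid. bernoulli_weight p (W e)) *
        ((\<Prod>j = 1..N. bernoulli_weight p (w j)) * dist_det p n N k (\<lambda>j. passage W m j + w j))"
    if w: "w \<in> {1..N} \<rightarrow>\<^sub>E {0, 1}" for W w
  proof -
    have "dist_det p n N k (passage (?E W w) (Suc m)) =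
        dist_det p n N k (\<lambda>j. passage (?E W w) m j + ?E W w (Suc m, j))"
      by (rule dist_det_passage_Suc) (use PiE_mem[OF w] in force)
    also have "\<dots> = dist_det p n N k (\<lambda>j. passage W m j + w j)"
      by (intro dist_det_cong arg_cong2[of _ _ _ _ "(+)"] passage_cong) auto
    finally have 1: "dist_det p n N k (passage (?E W w) (Suc m)) =
        dist_det p n N k (\<lambda>j. passage W m j + w j)" .
    have 2: "(\<Prod>e\<in>?grid. bernoulli_weight p (?E W w e)) = (\<Prod>e\<in>?grid. bernoulli_weight p (W e))"
      by (rule prod.cong) auto
    show ?thesis
      unfolding 1 prod_grid_Suc 2 by (simp add: mult_ac)
  qed
  have "(\<Sum>W\<in>{1..Suc m} \<times> {1..N} \<rightarrow>\<^sub>E {0, 1}.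
      (\<Prod>e\<in>{1..Suc m} \<times> {1..N}. bernoulli_weight p (W e)) * dist_det p n N k (passage W (Suc m))) =
    (\<Sum>W\<in>?grid \<rightarrow>\<^sub>E {0, 1}. \<Sum>w\<in>{1..N} \<rightarrow>\<^sub>E {0, 1}.
      (\<Prod>e\<in>?grid. bernoulli_weight p (W e)) *
        ((\<Prod>j = 1..N. bernoulli_weight p (w j)) * dist_det p n N k (\<lambda>j. passage W m j + w j)))"
    unfolding sum_grid_Suc by (intro sum.cong refl step)
  also have "\<dots> = (\<Sum>W\<in>?grid \<rightarrow>\<^sub>E {0, 1}.
      (\<Prod>e\<in>?grid. bernoulli_weight p (W e)) * dist_det p n N (Suc k) (passage W m))"
    by (simp only: sum_distrib_left[symmetric] dist_det_step)
  finally show ?case using Suc[of "Suc k"] by simp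
qed

section \<open>Krawtchouk polynomials\<close>

lemma geometric_gf_power_nth: "fps_nth (geometric_gf ^ Suc k) t = real ((t + k) choose k)"
proof (induction k arbitrary: t)
  case 0
  then show ?case by (simp add: geometric_gf_nth)
next
  case (Suc k)
  \<comment> \<open>Comparing coefficients in this relation gives Pascal's rule.\<close>
  have rec: "(1 - fps_X) * geometric_gf ^ Suc (Suc k) = geometric_gf ^ Suc k"
    by (simp add: one_minus_X_mult_geometric_gf flip: mult.assoc)
  show ?case
  proof (induction t)
    case 0
    then show ?case
      by (simp add: geometric_gf_nth fps_nth_power_0)
  next
    case (Suc t)
    then show ?case
      using one_minus_X_mult_nth[of "geometric_gf ^ Suc (Suc k)" "Suc t"] \<open>\<And>t. fps_nth (geometric_gf ^ Suc k) t = _\<close>[of "Suc t"]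
      unfolding rec by simp
  qed
qed

lemma bernoulli_gf_power_nth: "fps_nth (bernoulli_gf p ^ m) h = real (m choose h) * p ^ h * (1 - p) ^ (m - h)"
proof (induction m arbitrary: h)
  case (Suc m)
  have "fps_nth (bernoulli_gf p ^ Suc m) h =
      (1 - p) * fps_nth (bernoulli_gf p ^ m) h + p * (if h = 0 then 0 else fps_nth (bernoulli_gf p ^ m) (h - 1))"
    by (simp add: bernoulli_gf_def distrib_right mult.assoc)
  also have "\<dots> = real (Suc m choose h) * p ^ h * (1 - p) ^ (Suc m - h)"
  proof (cases h)
    case (Suc l)
    \<comment> \<open>If \<open>Suc l > m\<close>, the truncated exponents need not match, but the
      binomial coefficient is zero.\<close>
    have "(1 - p) * (real (m choose Suc l) * p ^ Suc l * (1 - p) ^ (m - Suc l)) =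
        real (m choose Suc l) * p ^ Suc l * (1 - p) ^ (m - l)"
      by (cases "Suc l \<le> m") (auto simp: binomial_eq_0 simp flip: power_Suc Suc_diff_Suc)
    then show ?thesis
      by (simp only: Suc Suc.IH) (simp add: algebra_simps)
  qed (simp add: Suc.IH)
  finally show ?case .
qed simp

section \<open>Krawtchouk polynomials through their generating function\<close>

definition binomial_poly :: "nat \<Rightarrow> real poly" where
  "binomial_poly k = Polynomial.smult (1 / fact k) (\<Prod>i<k. [:- real i, 1:])"

lemma poly_binomial_poly: "poly (binomial_poly k) (real h) = real (h choose k)"
  by (simp add: binomial_poly_def poly_prod binomial_gbinomial gbinomial_prod_rev atLeast0LessThan)

lemma degree_binomial_poly: "degree (binomial_poly k) = k"
  by (simp add: binomial_poly_def degree_prod_eq_sum_degree)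

lemma coeff_binomial_poly: "coeff (binomial_poly k) k = 1 / fact k"
proof -
  have "lead_coeff (\<Prod>i<k. [:- real i, 1:]) = 1"
    by (simp add: lead_coeff_prod)
  moreover have "degree (\<Prod>i<k. [:- real i, 1:]) = k"
    by (simp add: degree_prod_eq_sum_degree)
  ultimately have "coeff (\<Prod>i<k. [:- real i, 1:]) k = 1" by metis
  then show ?thesis by (simp add: binomial_poly_def)
qed

text \<open>The normalisation is the one for which the Rodrigues-type formula
  \<open>krawtchouk_poly_gf\<close> holds without a constant.\<close>

definition krawtchouk_poly :: "nat \<Rightarrow> real \<Rightarrow> nat \<Rightarrow> real poly" where
  "krawtchouk_poly K p r = Polynomial.smult (1 / (1 - p) ^ r)
     (\<Sum>i\<le>r. Polynomial.smult (real (r choose i) * (-1) ^ i / (real (K choose i) * p ^ i)) (binomial_poly i))"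

lemma degree_krawtchouk_poly: "degree (krawtchouk_poly K p r) \<le> r"
  unfolding krawtchouk_poly_def
  by (intro order.trans[OF degree_smult_le] degree_sum_le)
     (auto intro: order.trans[OF degree_smult_le] simp: degree_binomial_poly)

lemma coeff_krawtchouk_poly:
  "coeff (krawtchouk_poly K p r) r = (-1) ^ r / (real (K choose r) * fact r * (p * (1 - p)) ^ r)"
proof -
  have "(\<Sum>i\<le>r. real (r choose i) * (-1) ^ i / (real (K choose i) * p ^ i) * coeff (binomial_poly i) r) =
      (-1) ^ r / (real (K choose r) * p ^ r) * (1 / fact r)"
    by (subst sum.remove[of _ r])
       (auto simp: coeff_binomial_poly degree_binomial_poly intro!: sum.neutral coeff_eq_0)
  then show ?thesis
    by (simp add: krawtchouk_poly_def coeff_sum power_mult_distrib mult_ac)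
qed

text \<open>The factor \<open>z^i\<close> shifts the binomial weights for \<open>K - i\<close> by
  \<open>i\<close>, and \<open>(K choose h) (h choose i) = (K choose i) (K - i choose h - i)\<close>
  turns them into the weights for \<open>K\<close> times a multiple of
  \<open>h choose i\<close>.\<close>

lemma X_power_mult_bernoulli_gf_power_nth:
  assumes "i \<le> K" "0 < p"
  shows "fps_nth (fps_X ^ i * bernoulli_gf p ^ (K - i)) h =
    real (K choose h) * p ^ h * (1 - p) ^ (K - h) * real (h choose i) / (real (K choose i) * p ^ i)"
proof (cases "i \<le> h \<and> h \<le> K")
  case True
  then have "real (K choose h) * real (h choose i) = real (K choose i) * real (K - i choose (h - i))"
    by (metis choose_mult of_nat_mult)
  moreover have "K choose i \<noteq> 0" using assms by simp
  moreover have "p ^ h = p ^ i * p ^ (h - i)"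
    using True by (simp flip: power_add)
  ultimately show ?thesis
    using True assms by (simp add: fps_X_power_mult_nth bernoulli_gf_power_nth field_simps)
next
  case False
  then show ?thesis
    using assms by (auto simp: fps_X_power_mult_nth bernoulli_gf_power_nth binomial_eq_0)
qed

text \<open>Since \<open>(1 - p) (1 - z) = (1 - p + p z) - z\<close>, the power
  \<open>(1 - z)^r\<close> expands into terms \<open>z^i (1 - p + p z)^(r - i)\<close>. The other
  factor completes each to \<open>z^i (1 - p + p z)^(K - i)\<close>, which generates the weight
  times \<open>h choose i\<close> up to a constant.\<close>

lemma krawtchouk_poly_gf:
  assumes "r \<le> K" "0 < p" "p < 1"
  shows "fps_nth (bernoulli_gf p ^ (K - r) * (1 - fps_X) ^ r) h =
    real (K choose h) * p ^ h * (1 - p) ^ (K - h) * poly (krawtchouk_poly K p r) (real h)"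
proof -
  let ?w = "real (K choose h) * p ^ h * (1 - p) ^ (K - h)"
  have "fps_const (1 - p) * (1 - fps_X) = - fps_X + bernoulli_gf p"
    by (simp add: bernoulli_gf_def algebra_simps flip: fps_const_sub)
  moreover have "fps_const (1 / (1 - p)) * (fps_const (1 - p) * (1 - fps_X)) = 1 - fps_X"
    using assms by (simp only: mult.assoc[symmetric] fps_const_mult) simp
  ultimately have "1 - fps_X = fps_const (1 / (1 - p)) * (- fps_X + bernoulli_gf p)"
    by simp
  then have "bernoulli_gf p ^ (K - r) * (1 - fps_X) ^ r =
      fps_const (1 / (1 - p) ^ r) * (bernoulli_gf p ^ (K - r) * (- fps_X + bernoulli_gf p) ^ r)"
    by (simp add: power_mult_distrib fps_const_power power_one_over mult_ac)
  also have "bernoulli_gf p ^ (K - r) * (- fps_X + bernoulli_gf p) ^ r =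
      (\<Sum>i\<le>r. fps_const (real (r choose i) * (-1) ^ i) * (fps_X ^ i * bernoulli_gf p ^ (K - i)))"
    unfolding binomial_ring sum_distrib_left
  proof (rule sum.cong[OF refl])
    fix i assume "i \<in> {..r}"
    then have "bernoulli_gf p ^ (K - i) = bernoulli_gf p ^ (K - r) * bernoulli_gf p ^ (r - i)"
      using assms by (simp flip: power_add)
    moreover have "(- fps_X) ^ i = fps_const ((-1) ^ i) * (fps_X ^ i :: real fps)"
      by (subst power_minus) (simp flip: fps_const_power fps_const_neg)
    ultimately show "bernoulli_gf p ^ (K - r) * (of_nat (r choose i) * (- fps_X) ^ i * bernoulli_gf p ^ (r - i)) =
        fps_const (real (r choose i) * (-1) ^ i) * (fps_X ^ i * bernoulli_gf p ^ (K - i))"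
      by (simp add: fps_of_nat mult_ac flip: fps_const_mult)
  qed
  finally have "fps_nth (bernoulli_gf p ^ (K - r) * (1 - fps_X) ^ r) h = 1 / (1 - p) ^ r *
      (\<Sum>i\<le>r. real (r choose i) * (-1) ^ i * fps_nth (fps_X ^ i * bernoulli_gf p ^ (K - i)) h)"
    by (simp add: fps_sum_nth)
  also have "\<dots> = 1 / (1 - p) ^ r * (\<Sum>i\<le>r. ?w *
      (real (r choose i) * (-1) ^ i / (real (K choose i) * p ^ i) * real (h choose i)))"
  proof (rule arg_cong[OF sum.cong[OF refl]])
    fix i assume "i \<in> {..r}"
    then show "real (r choose i) * (-1) ^ i * fps_nth (fps_X ^ i * bernoulli_gf p ^ (K - i)) h =
        ?w * (real (r choose i) * (-1) ^ i / (real (K choose i) * p ^ i) * real (h choose i))"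
      using assms by (subst X_power_mult_bernoulli_gf_power_nth) auto
  qed
  finally show ?thesis
    by (simp add: krawtchouk_poly_def poly_sum poly_binomial_poly sum_distrib_left
        sum_divide_distrib mult_ac)
qed

section \<open>The Gram determinant and its normalisation\<close>

text \<open>For \<open>h \<le> H\<close> it interpolates the coefficient of
  \<open>geometric_gf ^ Suc k\<close> at \<open>H - h\<close>.\<close>

definition dual_poly :: "nat \<Rightarrow> nat \<Rightarrow> real poly" where
  "dual_poly H k = pcompose (binomial_poly k) [:real (H + k), -1:]"

lemma poly_dual_poly: "h \<le> H \<Longrightarrow> poly (dual_poly H k) (real h) = real ((H - h + k) choose k)"
  using poly_binomial_poly[of k "H - h + k"] by (simp add: dual_poly_def poly_pcompose of_nat_diff algebra_simps)

lemma degree_dual_poly: "degree (dual_poly H k) = k"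
  by (simp add: dual_poly_def degree_binomial_poly degree_pcompose)

lemma coeff_dual_poly: "coeff (dual_poly H k) k = (-1) ^ k / fact k"
proof -
  have "lead_coeff (dual_poly H k) =
      lead_coeff (binomial_poly k) * lead_coeff [:real (H + k), -1:] ^ degree (binomial_poly k)"
    unfolding dual_poly_def by (rule lead_coeff_comp) simp
  then show ?thesis
    by (simp add: degree_dual_poly degree_binomial_poly coeff_binomial_poly)
qed

text \<open>A single coefficient is the form that compares with \<open>kernel_entry\<close>; that it
  pairs two polynomials under the weight on \<open>{..H}\<close> is
  \<open>krawtchouk_gram_sum\<close>.\<close>

definition krawtchouk_gram :: "nat \<Rightarrow> nat \<Rightarrow> real \<Rightarrow> nat \<Rightarrow> nat \<Rightarrow> real" where
  "krawtchouk_gram K H p r k = fps_nth (bernoulli_gf p ^ (K - r) * (1 - fps_X) ^ r * geometric_gf ^ Suc k) H"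

text \<open>Multiplication by \<open>geometric_gf ^ Suc k\<close> is a convolution: at
  \<open>H\<close> it sums the weight times its polynomial against the values of
  \<open>dual_poly\<close>.\<close>

lemma krawtchouk_gram_sum:
  assumes "r \<le> K" "0 < p" "p < 1"
  shows "krawtchouk_gram K H p r k = (\<Sum>h\<le>H. real (K choose h) * p ^ h * (1 - p) ^ (K - h) *
    poly (krawtchouk_poly K p r) (real h) * poly (dual_poly H k) (real h))"
  unfolding krawtchouk_gram_def fps_mult_nth[of _ "geometric_gf ^ Suc k"] krawtchouk_poly_gf[OF assms] geometric_gf_power_nth
  by (rule sum.cong) (auto simp: poly_dual_poly)

text \<open>Expanding \<open>bernoulli_gf p = X + (1 - p) (1 - X)\<close> shows that the two determinants differ by a
  unitriangular row transformation.\<close>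

lemma dist_det_eq_krawtchouk_gram:
  assumes "1 \<le> N"
  shows "dist_det p n N M (\<lambda>_. 0) = fdet N (krawtchouk_gram (N + M - 1) (n + N - 1) p)"
proof -
  \<comment> \<open>These are the coefficients in the expansion of
    \<open>bernoulli_gf p ^ (N - 1 - r)\<close>, where \<open>N - 1 - r\<close> is the excess of the
    exponent \<open>N + M - 1 - r\<close> in the Gram entry over \<open>M\<close>.\<close>
  define U where
    "U r t = (if r \<le> t then real ((N - 1 - r) choose (t - r)) * (1 - p) ^ (t - r) else 0)" for r t
  have U: "fdet N U = 1"
    by (subst fdet_upper_triangular) (auto simp: U_def)
  have "krawtchouk_gram (N + M - 1) (n + N - 1) p r k = (\<Sum>t<N. U r t * kernel_entry p n M t k 0)" if "r < N" for r k
  proof -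
    define d where "d = N - 1 - r"
    define F where "F = geometric_gf ^ Suc k * bernoulli_gf p ^ M"
    have N: "N = Suc (r + d)" using that by (simp add: d_def)
    have "bernoulli_gf p = fps_const (1 - p) * (1 - fps_X) + fps_X"
      by (simp add: bernoulli_gf_def algebra_simps flip: fps_const_sub)
    then have "bernoulli_gf p ^ d = (\<Sum>s\<le>d. of_nat (d choose s) * (fps_const (1 - p) * (1 - fps_X)) ^ s * fps_X ^ (d - s))"
      by (simp only: binomial_ring)
    then have "bernoulli_gf p ^ (N + M - 1 - r) * (1 - fps_X) ^ r * geometric_gf ^ Suc k =
        (\<Sum>s\<le>d. fps_const (real (d choose s) * (1 - p) ^ s) * (fps_X ^ (d - s) * ((1 - fps_X) ^ (r + s) * F)))"
      by (simp add: N F_def power_add power_mult_distrib fps_of_nat[symmetric] sum_distrib_left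
            sum_distrib_right mult_ac fps_const_power flip: fps_const_mult)
    then have "krawtchouk_gram (N + M - 1) (n + N - 1) p r k = (\<Sum>s\<le>d. real (d choose s) * (1 - p) ^ s *
        fps_nth (fps_X ^ (d - s) * ((1 - fps_X) ^ (r + s) * F)) (n + r + d))"
      by (simp add: krawtchouk_gram_def fps_sum_nth N add.assoc)
    also have "\<dots> = (\<Sum>s\<le>d. U r (r + s) * kernel_entry p n M (r + s) k 0)"
    proof (rule sum.cong[OF refl])
      fix s assume "s \<in> {..d}"
      \<comment> \<open>Removing \<open>z^(d - s)\<close> lowers the index
        \<open>n + N - 1 = n + r + d\<close> to \<open>n + (r + s)\<close>, the index of row
        \<open>r + s\<close> at \<open>x = 0\<close>. This fixes the bound
        \<open>n + N - 1\<close>.\<close>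
      then have "fps_nth (fps_X ^ (d - s) * ((1 - fps_X) ^ (r + s) * F)) (n + r + d) =
          fps_nth ((1 - fps_X) ^ (r + s) * F) (n + (r + s))"
        by (simp add: fps_X_power_mult_nth add.assoc)
      also have "\<dots> = kernel_entry p n M (r + s) k 0"
        by (simp add: kernel_entry_def coefz_def F_def nat_add_distrib mult.assoc)
      finally show "real (d choose s) * (1 - p) ^ s *
          fps_nth (fps_X ^ (d - s) * ((1 - fps_X) ^ (r + s) * F)) (n + r + d) =
          U r (r + s) * kernel_entry p n M (r + s) k 0"
        by (simp add: U_def d_def)
    qed
    also have "\<dots> = (\<Sum>t\<in>{r..<N}. U r t * kernel_entry p n M t k 0)"
      by (rule sum.reindex_bij_witness[where i = "\<lambda>t. t - r" and j = "\<lambda>s. r + s"]) (auto simp: N)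
    also have "\<dots> = (\<Sum>t<N. U r t * kernel_entry p n M t k 0)"
      by (rule sum.mono_neutral_left) (auto simp: U_def)
    finally show ?thesis .
  qed
  then have "fdet N (krawtchouk_gram (N + M - 1) (n + N - 1) p) = fdet N (\<lambda>r k. \<Sum>t<N. U r t * kernel_entry p n M t k 0)"
    by (intro fdet_cong) auto
  then show ?thesis
    by (simp add: fdet_mult U dist_det_def)
qed

lemma fdet_mult_cols: "fdet n (\<lambda>i j. c j * f i j) = (\<Prod>j<n. c j) * fdet n f"
  by (simp add: fdet_cols prod.distrib sum_distrib_left mult_ac)

text \<open>The signs cancel, \<open>r \<le> K\<close> makes the binomial coefficient a quotient of
  factorials, and the powers of \<open>p * (1 - p)\<close> add up to the exponent
  \<open>N * (N - 1) div 2\<close>.\<close>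

lemma krawtchouk_Z_inverse:
  assumes "N \<le> Suc K" "0 < p" "p < 1"
  shows "(\<Prod>r<N. coeff (krawtchouk_poly K p r) r) * (\<Prod>k<N. coeff (dual_poly H k) k) =
    fact N / krawtchouk_Z N K p"
proof -
  have "(\<Prod>r<N. coeff (krawtchouk_poly K p r) r) * (\<Prod>k<N. coeff (dual_poly H k) k) =
      (\<Prod>r<N. 1 / ((fact r / fact (K - r)) * fact K * (p * (1 - p)) ^ r))"
    unfolding prod.distrib[symmetric]
  proof (rule prod.cong[OF refl])
    fix r assume "r \<in> {..<N}"
    then have c: "real (K choose r) = fact K / (fact r * fact (K - r))"
      using assms by (intro binomial_fact) auto
    show "coeff (krawtchouk_poly K p r) r * coeff (dual_poly H r) r =
        1 / ((fact r / fact (K - r)) * fact K * (p * (1 - p)) ^ r)"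
      unfolding coeff_krawtchouk_poly coeff_dual_poly c by (simp add: field_simps flip: power_mult_distrib)
  qed
  also have "\<dots> = 1 / ((\<Prod>r<N. fact r / fact (K - r)) * fact K ^ N * (\<Prod>r<N. (p * (1 - p)) ^ r))"
    by (simp add: prod_dividef prod.distrib)
  also have "(\<Prod>r<N. (p * (1 - p)) ^ r) = (p * (1 - p)) ^ (N * (N - 1) div 2)"
    by (simp add: power_sum[symmetric] Sum_Ico_nat lessThan_atLeast0)
  finally show ?thesis
    by (simp add: krawtchouk_Z_def)
qed

text \<open>Andreief's identity gives a sum of products of two determinants. The weight leaves the
  columns of the first, and by \<open>fdet_poly_lead\<close> both reduce to Vandermonde determinants
  with leading coefficients. The factor \<open>N!\<close> of the identity cancels the one in
  \<open>krawtchouk_Z_inverse\<close>.\<close>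

lemma fdet_krawtchouk_gram:
  assumes "N \<le> Suc K" "0 < p" "p < 1"
  shows "fdet N (krawtchouk_gram K H p) = (\<Sum>h\<in>{1..N} \<rightarrow>\<^sub>E {..H}. krawtchouk_density N K p h)"
proof -
  let ?w = "\<lambda>h. real (K choose h) * p ^ h * (1 - p) ^ (K - h)"
  let ?f = "\<lambda>i x. ?w x * poly (krawtchouk_poly K p i) (real x)"
  let ?g = "\<lambda>i x. poly (dual_poly H i) (real x)"
  have "fact N * fdet N (krawtchouk_gram K H p) = fact N * fdet N (\<lambda>i j. \<Sum>x\<in>{..H}. ?f i x * ?g j x)"
    using assms by (intro arg_cong2[of _ _ _ _ "(*)"] fdet_cong refl krawtchouk_gram_sum) auto
  also have "\<dots> = (\<Sum>h\<in>{1..N} \<rightarrow>\<^sub>E {..H}.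
      fdet N (\<lambda>i j. ?f i (h (Suc j))) * fdet N (\<lambda>i j. ?g i (h (Suc j))))"
    by (rule sum_fdet_mult_fdet[symmetric]) simp
  also have "\<dots> = (\<Sum>h\<in>{1..N} \<rightarrow>\<^sub>E {..H}. fact N * krawtchouk_density N K p h)"
  proof (rule sum.cong[OF refl])
    fix h :: "nat \<Rightarrow> nat"
    have 1: "fdet N (\<lambda>i j. ?f i (h (Suc j))) =
        (\<Prod>j = 1..N. ?w (h j)) * ((\<Prod>i<N. coeff (krawtchouk_poly K p i) i) * vandermonde N h)"
      by (simp add: fdet_mult_cols fdet_poly_lead degree_krawtchouk_poly vandermonde_eq_fdet prod_Suc_shift[where f = "\<lambda>j. ?w (h j)"])
    have 2: "fdet N (\<lambda>i j. ?g i (h (Suc j))) = (\<Prod>i<N. coeff (dual_poly H i) i) * vandermonde N h"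
      by (simp add: fdet_poly_lead degree_dual_poly vandermonde_eq_fdet)
    have "fdet N (\<lambda>i j. ?f i (h (Suc j))) * fdet N (\<lambda>i j. ?g i (h (Suc j))) =
        ((\<Prod>i<N. coeff (krawtchouk_poly K p i) i) * (\<Prod>i<N. coeff (dual_poly H i) i)) *
        ((vandermonde N h)\<^sup>2 * (\<Prod>j = 1..N. ?w (h j)))"
      unfolding 1 2 by (simp only: power2_eq_square mult_ac)
    then show "fdet N (\<lambda>i j. ?f i (h (Suc j))) * fdet N (\<lambda>i j. ?g i (h (Suc j))) =
        fact N * krawtchouk_density N K p h"
      unfolding krawtchouk_Z_inverse[OF assms] krawtchouk_density_def by (simp add: mult_ac)
  qed
  finally show ?thesis
    by (simp flip: sum_distrib_left)
qed

lemma krawtchouk_density_nonneg: "0 < p \<Longrightarrow> p < 1 \<Longrightarrow> 0 \<le> krawtchouk_density N K p h"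
  unfolding krawtchouk_density_def krawtchouk_Z_def
  by (intro mult_nonneg_nonneg prod_nonneg divide_nonneg_nonneg) auto

lemma krawtchouk_density_eq_0:
  assumes "1 \<le> j" "j \<le> N" "K < h j"
  shows "krawtchouk_density N K p h = 0"
proof -
  have "(\<Prod>j = 1..N. real (K choose h j) * p ^ h j * (1 - p) ^ (K - h j)) = 0"
    using assms by (intro prod_zero bexI[of _ j]) auto
  then show ?thesis by (simp add: krawtchouk_density_def)
qed

text \<open>The sum may run up to \<open>H\<close> even if \<open>H > K\<close>: configurations
  beyond \<open>K\<close> lie outside the ensemble, but a vanishing binomial coefficient gives them
  density 0.\<close>

lemma measure_krawtchouk_ensemble:
  assumes "1 \<le> N" "0 < p" "p < 1"
  shows "measure (krawtchouk_ensemble N K p) {h \<in> space (krawtchouk_ensemble N K p). Max (h ` {1..N}) \<le> H} =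
    (\<Sum>h\<in>{1..N} \<rightarrow>\<^sub>E {..H}. krawtchouk_density N K p h)"
proof -
  let ?A = "{1..N} \<rightarrow>\<^sub>E {0..K}"
  let ?X = "{h \<in> ?A. Max (h ` {1..N}) \<le> H}"
  have fin: "finite ?A" by (intro finite_PiE) auto
  have X: "?X = {1..N} \<rightarrow>\<^sub>E ({..H} \<inter> {..K})"
    using assms by (auto simp: PiE_iff extensional_def)
  have "measure (krawtchouk_ensemble N K p) {h \<in> space (krawtchouk_ensemble N K p). Max (h ` {1..N}) \<le> H} =
      measure (point_measure ?A (\<lambda>h. ennreal (krawtchouk_density N K p h))) ?X"
    by (simp add: krawtchouk_ensemble_def space_point_measure)
  also have "\<dots> = (\<Sum>h\<in>?X. krawtchouk_density N K p h)"
    unfolding Sigma_Algebra.measure_def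
    by (subst emeasure_point_measure_finite[OF fin])
       (auto simp: sum_nonneg krawtchouk_density_nonneg assms)
  also have "\<dots> = (\<Sum>h\<in>{1..N} \<rightarrow>\<^sub>E {..H}. krawtchouk_density N K p h)"
    unfolding X
  proof (rule sum.mono_neutral_left)
    show "\<forall>h\<in>({1..N} \<rightarrow>\<^sub>E {..H}) - ({1..N} \<rightarrow>\<^sub>E {..H} \<inter> {..K}). krawtchouk_density N K p h = 0"
    proof
      fix h assume "h \<in> ({1..N} \<rightarrow>\<^sub>E {..H}) - ({1..N} \<rightarrow>\<^sub>E {..H} \<inter> {..K})"
      then obtain j where "1 \<le> j" "j \<le> N" "K < h j"
        by (auto simp: PiE_iff not_le)
      then show "krawtchouk_density N K p h = 0" by (rule krawtchouk_density_eq_0)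
    qed
  qed (auto intro!: finite_PiE simp: PiE_iff)
  finally show ?thesis .
qed

section \<open>Last-passage times\<close>

lemma sum_row_path: "(\<Sum>e\<in>(\<lambda>k. (k, j k)) ` A. f e) = (\<Sum>k\<in>A. f (k, j k))"
  by (subst sum.reindex) (auto simp: inj_on_def)

text \<open>Cut off the last entry: by monotonicity the rest of the path stays within the columns up
  to \<open>j (Suc m)\<close>, where the induction hypothesis applies.\<close>

lemma sum_path_le_passage:
  assumes "j ` {1..m} \<subseteq> {1..l}" "mono_on {1..m} j"
  shows "(\<Sum>k = 1..m. W (k, j k)) \<le> passage W m l"
  using assms
proof (induction m arbitrary: l)
  case (Suc m)
  have j_last: "j (Suc m) \<in> {1..l}"
    using Suc.prems(1) by (simp add: image_subset_iff)
  then obtain i where i: "j (Suc m) = Suc i"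
    by (cases "j (Suc m)") auto
  have "(\<Sum>k = 1..m. W (k, j k)) \<le> passage W m (Suc i)"
  proof (rule Suc.IH)
    show "mono_on {1..m} j"
      using Suc.prems(2) by (rule mono_on_subset) auto
    show "j ` {1..m} \<subseteq> {1..Suc i}"
      using Suc.prems mono_onD[OF Suc.prems(2), of _ "Suc m"] by (fastforce simp: i)
  qed
  then have "(\<Sum>k = 1..Suc m. W (k, j k)) \<le> passage W (Suc m) (Suc i)"
    by (simp add: i)
  also have "\<dots> \<le> passage W (Suc m) l"
    using j_last by (intro passage_mono) (simp add: i)
  finally show ?case .
qed simp

text \<open>A maximal path is traced back along whichever branch of the recursion attains the
  maximum.\<close>

lemma passage_attained:
  assumes "1 \<le> l"
  obtains j where "j ` {1..m} \<subseteq> {1..l}" "mono_on {1..m} j"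
    "(\<Sum>k = 1..m. W (k, j k)) = passage W m l"
proof -
  have "\<exists>j. j ` {1..m} \<subseteq> {1..l} \<and> mono_on {1..m} j \<and> (\<Sum>k = 1..m. W (k, j k)) = passage W m l"
    using assms
  proof (induction W m l rule: passage.induct)
    case (3 W m l)
    show ?case
    \<comment> \<open>For \<open>l = 0\<close> the first branch would leave no column for a path;
      its value there is 0, so the second branch attains the maximum.\<close>
    proof (cases "1 \<le> l \<and> passage W (Suc m) (Suc l) = passage W (Suc m) l")
      case True
      then obtain j where j: "j ` {1..Suc m} \<subseteq> {1..l}" "mono_on {1..Suc m} j"
        "(\<Sum>k = 1..Suc m. W (k, j k)) = passage W (Suc m) (Suc l)"
        using "3.IH"(1) by metis
      moreover have "{1..l} \<subseteq> {1..Suc l}" by simp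
      ultimately show ?thesis by (meson order_trans)
    next
      case False
      then have eq: "passage W (Suc m) (Suc l) = passage W m (Suc l) + W (Suc m, Suc l)"
        by (cases "l = 0") (auto simp: max_def split: if_splits)
      obtain j where j: "j ` {1..m} \<subseteq> {1..Suc l}" "mono_on {1..m} j"
        "(\<Sum>k = 1..m. W (k, j k)) = passage W m (Suc l)"
        using "3.IH"(2) by auto
      let ?j = "j(Suc m := Suc l)"
      have "?j ` {1..Suc m} \<subseteq> {1..Suc l}"
        using j(1) by (auto simp: le_Suc_eq image_subset_iff)
      moreover have "mono_on {1..Suc m} ?j"
      proof (rule mono_onI)
        fix r s assume "r \<in> {1..Suc m}" "s \<in> {1..Suc m}" "r \<le> s"
        then show "?j r \<le> ?j s"
          using j(1) mono_onD[OF j(2), of r s] by (auto simp: le_Suc_eq image_subset_iff)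
      qed
      moreover have "(\<Sum>k = 1..Suc m. W (k, ?j k)) = passage W (Suc m) (Suc l)"
        unfolding eq j(3)[symmetric] by (simp cong: sum.cong_simp)
      ultimately show ?thesis by blast
    qed
  qed (auto intro: mono_onI)
  then show thesis using that by blast
qed

lemma row_paths_subset: "\<pi> \<in> row_paths M N \<Longrightarrow> \<pi> \<subseteq> {1..M} \<times> {1..N}"
  by (auto simp: row_paths_def)

lemma finite_row_paths: "finite (row_paths M N)"
  by (rule finite_subset[of _ "Pow ({1..M} \<times> {1..N})"]) (use row_paths_subset in blast, simp)

lemma last_passage_eq_passage:
  assumes "1 \<le> N" and w: "\<And>e. e \<in> {1..M} \<times> {1..N} \<Longrightarrow> w e = real (W e)"
  shows "last_passage M N w = real (passage W M N)"
  unfolding last_passage_def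
proof (rule Max_eqI)
  have sum_w: "(\<Sum>e\<in>(\<lambda>k. (k, j k)) ` {1..M}. w e) = real (\<Sum>k = 1..M. W (k, j k))"
    if "j ` {1..M} \<subseteq> {1..N}" for j
    unfolding sum_row_path of_nat_sum by (rule sum.cong[OF refl], rule w) (use that in \<open>auto simp: image_subset_iff\<close>)
  show "finite ((\<lambda>\<pi>. \<Sum>e\<in>\<pi>. w e) ` row_paths M N)"
    by (simp add: finite_row_paths)
  show "y \<le> real (passage W M N)" if mem: "y \<in> (\<lambda>\<pi>. \<Sum>e\<in>\<pi>. w e) ` row_paths M N" for y
  proof -
    obtain \<pi> where "\<pi> \<in> row_paths M N" and y: "y = (\<Sum>e\<in>\<pi>. w e)"
      using mem by blast
    then obtain j where j: "j ` {1..M} \<subseteq> {1..N}" "mono_on {1..M} j"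
      and "\<pi> = (\<lambda>k. (k, j k)) ` {1..M}"
      unfolding row_paths_def by blast
    with y have "y = (\<Sum>e\<in>(\<lambda>k. (k, j k)) ` {1..M}. w e)"
      by (simp only:)
    with j show ?thesis
      using sum_path_le_passage[OF j(1,2), of W] by (simp only: sum_w of_nat_le_iff)
  qed
  obtain j where j: "j ` {1..M} \<subseteq> {1..N}" "mono_on {1..M} j"
    "(\<Sum>k = 1..M. W (k, j k)) = passage W M N"
    using passage_attained[OF assms(1)] .
  then have "(\<lambda>k. (k, j k)) ` {1..M} \<in> row_paths M N"
    unfolding row_paths_def by blast
  moreover have "real (passage W M N) = (\<Sum>e\<in>(\<lambda>k. (k, j k)) ` {1..M}. w e)"
    unfolding sum_w[OF j(1)] j(3) ..
  ultimately show "real (passage W M N) \<in> (\<lambda>\<pi>. \<Sum>e\<in>\<pi>. w e) ` row_paths M N"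
    by blast
qed

section \<open>From random entries to a finite sum\<close>

text \<open>The variables are 0 or 1 only almost surely. The events \<open>E W\<close> that fix all
  entries are disjoint and have product probabilities by independence; these sum to 1, so up to a
  null set the event is a union of such \<open>E W\<close>.\<close>

lemma (in prob_space) prob_eq_sum_bernoulli:
  fixes w :: "'i \<Rightarrow> 'a \<Rightarrow> real"
  assumes I: "finite I" "I \<noteq> {}" and indep: "indep_vars (\<lambda>_. borel) w I"
    and one: "\<And>e. e \<in> I \<Longrightarrow> prob {\<omega> \<in> space M. w e \<omega> = 1} = p"
    and zero: "\<And>e. e \<in> I \<Longrightarrow> prob {\<omega> \<in> space M. w e \<omega> = 0} = 1 - p"
    and A: "{\<omega> \<in> space M. Q \<omega>} \<in> events"
    and Q: "\<And>\<omega> W. \<omega> \<in> space M \<Longrightarrow> W \<in> I \<rightarrow>\<^sub>E {0, 1} \<Longrightarrow>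
      (\<And>e. e \<in> I \<Longrightarrow> w e \<omega> = real (W e)) \<Longrightarrow> Q \<omega> \<longleftrightarrow> R W"
  shows "prob {\<omega> \<in> space M. Q \<omega>} =
    (\<Sum>W\<in>I \<rightarrow>\<^sub>E {0, 1}. (\<Prod>e\<in>I. bernoulli_weight p (W e)) * (if R W then 1 else 0))"
proof -
  let ?C = "I \<rightarrow>\<^sub>E {0, 1 :: nat}"
  define E where "E W = {\<omega> \<in> space M. \<forall>e\<in>I. w e \<omega> = real (W e)}" for W
  have finC: "finite ?C" using I by (intro finite_PiE) auto
  have E_Int: "E W = (\<Inter>e\<in>I. {\<omega> \<in> space M. w e \<omega> = real (W e)})" for W
    using I by (auto simp: E_def)
  have rv: "w e \<in> borel_measurable M" if "e \<in> I" for e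
    using indep that by (auto simp: indep_vars_def2)
  have E_events: "E W \<in> events" for W
    unfolding E_Int using I rv by (intro sets.finite_INT) auto
  have E_prob: "prob (E W) = (\<Prod>e\<in>I. bernoulli_weight p (W e))" if W: "W \<in> ?C" for W
  proof -
    have "indep_events (\<lambda>e. {\<omega> \<in> space M. w e \<omega> = real (W e)}) I"
      using indep by (rule indep_eventsI_indep_vars) auto
    then have "prob (E W) = (\<Prod>e\<in>I. prob {\<omega> \<in> space M. w e \<omega> = real (W e)})"
      unfolding E_Int using I by (auto simp: indep_events_def)
    also have "\<dots> = (\<Prod>e\<in>I. bernoulli_weight p (W e))"
    proof (rule prod.cong[OF refl])
      fix e assume "e \<in> I"
      then have "W e = 0 \<or> W e = 1" using W by auto
      then show "prob {\<omega> \<in> space M. w e \<omega> = real (W e)} = bernoulli_weight p (W e)"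
        using one[OF \<open>e \<in> I\<close>] zero[OF \<open>e \<in> I\<close>] by (auto simp: bernoulli_weight_def)
    qed
    finally show ?thesis .
  qed
  have disj: "disjoint_family_on E S" if "S \<subseteq> ?C" for S
    unfolding disjoint_family_on_def
  proof (intro ballI impI)
    fix W W' assume *: "W \<in> S" "W' \<in> S" "W \<noteq> W'"
    then have "W \<in> ?C" "W' \<in> ?C" using that by (simp_all only: subsetD)
    then obtain e where "e \<in> I" "W e \<noteq> W' e"
      using PiE_ext \<open>W \<noteq> W'\<close> by metis
    then show "E W \<inter> E W' = {}" by (auto simp: E_def)
  qed
  have prob_UN: "prob (\<Union>W\<in>S. E W) = (\<Sum>W\<in>S. \<Prod>e\<in>I. bernoulli_weight p (W e))" if "S \<subseteq> ?C" for S
  proof -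
    have "prob (\<Union>W\<in>S. E W) = (\<Sum>W\<in>S. prob (E W))"
      using E_events disj[OF that] finite_subset[OF that finC]
      by (intro finite_measure_finite_Union) auto
    then show ?thesis using that by (simp add: E_prob subset_iff)
  qed
  have "(\<Sum>W\<in>?C. \<Prod>e\<in>I. bernoulli_weight p (W e)) = (\<Prod>e\<in>I. \<Sum>b\<in>{0, 1}. bernoulli_weight p b)"
    using I by (intro prod_sum_PiE[symmetric]) auto
  then have "prob (\<Union>W\<in>?C. E W) = 1"
    by (simp add: prob_UN bernoulli_weight_def)
  moreover have "(\<Union>W\<in>?C. E W) \<in> events"
    using finC E_events by (intro sets.finite_UN) auto
  ultimately have "AE \<omega> in M. \<omega> \<in> (\<Union>W\<in>?C. E W)"
    by (simp add: prob_eq_1)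
  \<comment> \<open>Almost every point lies in exactly one \<open>E W\<close>, and there
    \<open>Q\<close> is decided by \<open>W\<close>.\<close>
  then have "AE \<omega> in M. \<omega> \<in> {\<omega> \<in> space M. Q \<omega>} \<longleftrightarrow> \<omega> \<in> (\<Union>W\<in>{W \<in> ?C. R W}. E W)"
  proof eventually_elim
    case (elim \<omega>)
    then obtain W where W: "W \<in> ?C" "\<omega> \<in> E W" by blast
    have "W' = W" if "W' \<in> ?C" "\<omega> \<in> E W'" for W'
      using disj[OF order.refl] W that by (auto simp: disjoint_family_on_def)
    moreover have "\<omega> \<in> space M" "Q \<omega> \<longleftrightarrow> R W"
      using W Q[of \<omega> W] by (auto simp: E_def)
    ultimately show ?case using W by blast
  qed
  then have "prob {\<omega> \<in> space M. Q \<omega>} = prob (\<Union>W\<in>{W \<in> ?C. R W}. E W)"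
    using A finC E_events by (intro finite_measure_eq_AE sets.finite_UN) auto
  also have "\<dots> = (\<Sum>W\<in>{W \<in> ?C. R W}. \<Prod>e\<in>I. bernoulli_weight p (W e))"
    by (rule prob_UN) auto
  also have "\<dots> = (\<Sum>W\<in>?C. (\<Prod>e\<in>I. bernoulli_weight p (W e)) * (if R W then 1 else 0))"
    using finC by (intro sum.mono_neutral_cong_left) auto
  finally show ?thesis .
qed

theorem proposition5p1:
  fixes M N n :: nat and p q :: real
    and \<Omega> :: "'a measure" and w :: "nat \<times> nat \<Rightarrow> 'a \<Rightarrow> real"
  assumes "M \<ge> 1" and "N \<ge> 1" and "0 < p" and "p < 1" and "q = 1 - p"
    and "prob_space \<Omega>"
    and "prob_space.indep_vars \<Omega> (\<lambda>_. borel) w ({1..M} \<times> {1..N})"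
    and "\<And>i j. i \<in> {1..M} \<Longrightarrow> j \<in> {1..N} \<Longrightarrow>
           measure \<Omega> {\<omega> \<in> space \<Omega>. w (i, j) \<omega> = 1} = p"
    and "\<And>i j. i \<in> {1..M} \<Longrightarrow> j \<in> {1..N} \<Longrightarrow>
           measure \<Omega> {\<omega> \<in> space \<Omega>. w (i, j) \<omega> = 0} = q"
  shows "measure \<Omega> {\<omega> \<in> space \<Omega>. last_passage M N (\<lambda>e. w e \<omega>) \<le> real n} =
         measure (krawtchouk_ensemble N (N + M - 1) p)
           {h \<in> space (krawtchouk_ensemble N (N + M - 1) p). Max (h ` {1..N}) \<le> n + N - 1}"
proof -
  interpret prob_space \<Omega> by fact
  let ?grid = "{1..M} \<times> {1..N}"
  have w_meas: "w e \<in> borel_measurable \<Omega>" if "e \<in> ?grid" for e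
    using assms(7) that by (auto simp: indep_vars_def2)
  have "(\<lambda>\<omega>. last_passage M N (\<lambda>e. w e \<omega>)) \<in> borel_measurable \<Omega>"
    unfolding last_passage_def
    by (intro borel_measurable_Max finite_row_paths borel_measurable_sum w_meas)
       (use row_paths_subset in blast)
  then have event: "{\<omega> \<in> space \<Omega>. last_passage M N (\<lambda>e. w e \<omega>) \<le> real n} \<in> events"
    by measurable
  have "prob {\<omega> \<in> space \<Omega>. last_passage M N (\<lambda>e. w e \<omega>) \<le> real n} =
      (\<Sum>W\<in>?grid \<rightarrow>\<^sub>E {0, 1}. (\<Prod>e\<in>?grid. bernoulli_weight p (W e)) * (if passage W M N \<le> n then 1 else 0))"
  proof (rule prob_eq_sum_bernoulli[OF _ _ assms(7) _ _ event])
    fix \<omega> and W :: "nat \<times> nat \<Rightarrow> nat"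
    assume "\<And>e. e \<in> ?grid \<Longrightarrow> w e \<omega> = real (W e)"
    then have "last_passage M N (\<lambda>e. w e \<omega>) = real (passage W M N)"
      by (rule last_passage_eq_passage[OF assms(2)])
    then show "last_passage M N (\<lambda>e. w e \<omega>) \<le> real n \<longleftrightarrow> passage W M N \<le> n"
      by simp
  qed (use assms in auto)
  \<comment> \<open>Since \<open>passage W M\<close> is weakly increasing, the determinant at time 0
    is the indicator of \<open>passage W M N \<le> n\<close>.\<close>
  also have "\<dots> = (\<Sum>W\<in>?grid \<rightarrow>\<^sub>E {0, 1}. (\<Prod>e\<in>?grid. bernoulli_weight p (W e)) * dist_det p n N 0 (passage W M))"
    using assms(2) by (simp add: dist_det_0 passage_mono)
  also have "\<dots> = dist_det p n N M (\<lambda>_. 0)"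
    using expectation_dist_det[where k = 0] by simp
  also have "\<dots> = fdet N (krawtchouk_gram (N + M - 1) (n + N - 1) p)"
    using assms(2) by (rule dist_det_eq_krawtchouk_gram)
  also have "\<dots> = (\<Sum>h\<in>{1..N} \<rightarrow>\<^sub>E {..n + N - 1}. krawtchouk_density N (N + M - 1) p h)"
    using assms by (intro fdet_krawtchouk_gram) auto
  also have "\<dots> = measure (krawtchouk_ensemble N (N + M - 1) p)
      {h \<in> space (krawtchouk_ensemble N (N + M - 1) p). Max (h ` {1..N}) \<le> n + N - 1}"
    using assms by (intro measure_krawtchouk_ensemble[symmetric]) auto
  finally show ?thesis .
qed

end
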